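(* Let $\mathcal{F}$ be a Fréchet space, $\mathcal{E}\subset\mathcal{F}$ a closed subspace, and $X:\mathcal{U}\subset\mathcal{F}\to\mathcal{F}$ a smooth map defined on an open subset $\mathcal{U}\subset\mathcal{F}$. Let $f\in\mathcal{F}$, put $\mathcal{E}_f:=\{f\}+\mathcal{E}$, and assume that $X(\mathcal{U}\cap\mathcal{E}_f)\subset\mathcal{E}$. Let $c:(-\varepsilon,\varepsilon)\to\mathcal{F}$ be a smooth curve with $c(0)\in\mathcal{U}\cap\mathcal{E}_f$ and $X\circ c(t)=\dot c(t)$. If for all $t\in(-\varepsilon,\varepsilon)$ $$c(t)=\sum_{k=0}^{\infty}\frac{t^k}{k!}c^{(k)}(0),$$ where $c^{(k)}$ is the $k$-th derivative of $c$ and the series converges with respect to the Fréchet topology in $\mathcal{F}$, then $$c(t)-c(0)\in\mathcal{E}\quad\text{for all }t\in(-\varepsilon,\varepsilon).$$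
   Context: A Fréchet space is a locally convex topological vector space that is metrizable, Hausdorff and complete. Smoothness is in the sense of Hamilton: a continuous map $P:\mathcal{U}\subset\mathcal{F}\to\mathcal{E}'$ between Fréchet spaces ($\mathcal{U}$ open) is $C^1$ if $DP(f)v=\lim_{t\to0}\frac1t(P(f+tv)-P(f))$ exists for all $f\in\mathcal{U}$, $v\in\mathcal{F}$ and $DP:\mathcal{U}\times\mathcal{F}\to\mathcal{E}'$ is continuous; inductively $P$ is $C^k$ if it is $C^{k-1}$, the directional derivatives $D^{(k)}P(f)\{v_1,\ldots,v_k\}$ of $f\mapsto D^{(k-1)}P(f)\{v_1,\ldots,v_{k-1}\}$ in the direction $v_k$ exist, and $D^{(k)}P:\mathcal{U}\times\mathcal{F}\times\cdots\times\mathcal{F}\to\mathcal{E}'$ is continuous; $P$ is smooth if it is $C^k$ for all $k$. The equation $X\circ c(t)=\dot c(t)$ is understood to hold for all $t\in(-\varepsilon,\varepsilon)$ (in particular $c(t)\in\mathcal{U}$). *)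

theory Defs
  imports "HOL-Analysis.Analysis"
begin

text \<open>
  Real Frechet spaces. The uniformity is no extra datum: joint uniform continuity of addition and
  uniform continuity of negation force it to be the translation-invariant uniformity generated by
  the sets of all \<open>(x, y)\<close> with \<open>y - x \<in> U\<close>, for \<open>U\<close> a neighbourhood of \<open>0\<close>.
  Hence completeness is the usual completeness of a topological vector space.
  No particular metric is chosen.
  Class assumptions cannot mention \<open>convex\<close> and \<open>euclidean\<close>, so both are written out;
  the lemmas after the class restate the assumptions with the library notions.
\<close>

class frechet_space =
  real_vector + topological_ab_group_add + uniform_topological_group_add +
  t2_space + complete_uniform_space +
  assumes tendsto_scaleR_Pair:
      "LIM p (nhds (r :: real) \<times>\<^sub>F nhds x). scaleR (fst p) (snd p) :> nhds (scaleR r x)"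
    and locally_convex: "open U \<Longrightarrow> 0 \<in> U \<Longrightarrow>
      \<exists>V. open V \<and> 0 \<in> V \<and> V \<subseteq> U \<and>
        (\<forall>x\<in>V. \<forall>y\<in>V. \<forall>u\<ge>0. \<forall>v\<ge>0. u + v = 1 \<longrightarrow> scaleR u x + scaleR v y \<in> V)"
    and metrizable: "metrizable_space (topology open)"

lemma frechet_continuous_scaleR:
  "continuous_on UNIV (\<lambda>(r :: real, x :: 'a::frechet_space). r *\<^sub>R x)"
  unfolding continuous_on_def split_def
proof
  fix p :: "real \<times> 'a"
  have "((\<lambda>q. fst q *\<^sub>R snd q) \<longlongrightarrow> fst p *\<^sub>R snd p) (nhds p)"
    using tendsto_scaleR_Pair[of "fst p" "snd p"] by (simp add: nhds_prod[symmetric])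
  then show "((\<lambda>q. fst q *\<^sub>R snd q) \<longlongrightarrow> fst p *\<^sub>R snd p) (at p)"
    by (rule tendsto_mono[rotated]) (simp add: at_within_def)
qed

lemma frechet_locally_convex:
  fixes U :: "'a::frechet_space set"
  assumes "open U" and "0 \<in> U"
  shows "\<exists>V. open V \<and> convex V \<and> 0 \<in> V \<and> V \<subseteq> U"
  using locally_convex[OF assms] unfolding convex_def by blast

lemma frechet_metrizable: "metrizable_space (euclidean :: 'a::frechet_space topology)"
  by (rule metrizable)

text \<open>In particular \<open>real\<close> is a Frechet space, so curves are covered by the general notion of smoothness.\<close>

instance banach \<subseteq> uniform_topological_group_add
  by (rule real_normed_vector_is_uniform_topological_group_add)

instance banach \<subseteq> frechet_space
proof
  show "LIM p (nhds r \<times>\<^sub>F nhds x). fst p *\<^sub>R snd p :> nhds (r *\<^sub>R x)" for r and x :: 'a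
    unfolding nhds_prod[symmetric]
    by (intro tendsto_scaleR) (auto intro: tendsto_eq_intros filterlim_ident)
  show "\<exists>V. open V \<and> 0 \<in> V \<and> V \<subseteq> U \<and>
      (\<forall>x\<in>V. \<forall>y\<in>V. \<forall>u\<ge>0. \<forall>v\<ge>0. u + v = 1 \<longrightarrow> u *\<^sub>R x + v *\<^sub>R y \<in> V)"
    if "open U" "0 \<in> U" for U :: "'a set"
    using that unfolding convex_def[symmetric]
    by (metis centre_in_ball convex_ball open_ball open_contains_ball)
  show "metrizable_space (euclidean :: 'a topology)"
    by (rule metrizable_space_euclidean)
qed

definition has_dir_deriv ::
  "('a::frechet_space \<Rightarrow> 'b::frechet_space) \<Rightarrow> 'a \<Rightarrow> 'a \<Rightarrow> 'b \<Rightarrow> bool" where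
  "has_dir_deriv P f v d \<longleftrightarrow> ((\<lambda>t::real. (1 / t) *\<^sub>R (P (f + t *\<^sub>R v) - P f)) \<longlongrightarrow> d) (at 0)"

definition dir_deriv :: "('a::frechet_space \<Rightarrow> 'b::frechet_space) \<Rightarrow> 'a \<Rightarrow> 'a \<Rightarrow> 'b" where
  "dir_deriv P f v = (THE d. has_dir_deriv P f v d)"

text \<open>
  \<open>iter_deriv k P f v\<close> is $D^{(k)}P(f)\{v_1,\ldots,v_k\}$ with $v_{i+1}$ given by \<open>v i\<close>;
  only \<open>v 0, \<dots>, v (k - 1)\<close> are used.
\<close>

primrec iter_deriv ::
  "nat \<Rightarrow> ('a::frechet_space \<Rightarrow> 'b::frechet_space) \<Rightarrow> 'a \<Rightarrow> (nat \<Rightarrow> 'a) \<Rightarrow> 'b" where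
  "iter_deriv 0 P f v = P f"
| "iter_deriv (Suc k) P f v = dir_deriv (\<lambda>g. iter_deriv k P g v) f (v k)"

text \<open>
  Hamilton's \<open>C\<^sup>k\<close> maps on \<open>U\<close>; the set \<open>U\<close> is meant to be open.
  The product topology over the index set \<open>{..<k}\<close> is the \<open>k\<close>-fold power of the space, with
  \<open>k\<close>-tuples represented by extensional functions.
\<close>

primrec Ck_on :: "nat \<Rightarrow> 'a::frechet_space set \<Rightarrow> ('a \<Rightarrow> 'b::frechet_space) \<Rightarrow> bool" where
  "Ck_on 0 U P \<longleftrightarrow> continuous_on U P"
| "Ck_on (Suc k) U P \<longleftrightarrow> Ck_on k U P \<and>
     (\<forall>f\<in>U. \<forall>v. \<exists>d. has_dir_deriv (\<lambda>g. iter_deriv k P g v) f (v k) d) \<and>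
     continuous_map
       (prod_topology (top_of_set U) (product_topology (\<lambda>_. euclidean) {..<Suc k}))
       euclidean (\<lambda>(f, v). iter_deriv (Suc k) P f v)"

definition smooth_map_on :: "'a::frechet_space set \<Rightarrow> ('a \<Rightarrow> 'b::frechet_space) \<Rightarrow> bool" where
  "smooth_map_on U P \<longleftrightarrow> (\<forall>k. Ck_on k U P)"

text \<open>The \<open>k\<close>-th derivative of a curve \<open>c\<close> is \<open>(curve_deriv ^^ k) c\<close>.\<close>

definition curve_deriv :: "(real \<Rightarrow> 'a::frechet_space) \<Rightarrow> real \<Rightarrow> 'a" where
  "curve_deriv c t = dir_deriv c t 1"

end

theory Submission
  imports Defs
begin

text \<open>
  The series reduces the claim to showing that every derivative \<open>c\<^sup>(\<^sup>k\<^sup>)(0)\<close> with \<open>k \<ge> 1\<close> lies in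
  \<open>E\<close>: then all partial sums of \<open>c(t) - c(0)\<close> lie in the closed subspace \<open>E\<close>, and so
  does their limit.

  Differentiating \<open>X \<circ> c\<close> repeatedly would lead to higher derivatives of \<open>X\<close> and a chain rule for
  them. Comparing \<open>c\<close> with its Taylor polynomials involves only first derivatives of \<open>X\<close>.
  Suppose that \<open>c\<^sup>(\<^sup>k\<^sup>)(0) \<in> E\<close> for \<open>1 \<le> k \<le> n\<close>, and let \<open>p\<close> be the Taylor polynomial of
  \<open>c\<close> at \<open>0\<close> of degree \<open>n\<close>. For small \<open>t\<close> the point \<open>p(t)\<close> lies in
  \<open>U \<inter> (f + E)\<close>, hence \<open>X(p(t)) \<in> E\<close>. Since \<open>c(t) - p(t)\<close> is \<open>o(t\<^sup>n)\<close> and \<open>X\<close> is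
  \<open>C\<^sup>1\<close>, also \<open>X(c(t)) - X(p(t))\<close> is \<open>o(t\<^sup>n)\<close>. On the other hand \<open>X(c(t))\<close> is the derivative of
  \<open>c\<close> at \<open>t\<close>, which up to \<open>o(t\<^sup>n)\<close> is its own Taylor polynomial of degree \<open>n\<close>; all
  coefficients of that polynomial except \<open>c\<^sup>(\<^sup>n\<^sup>+\<^sup>1\<^sup>)(0) / n!\<close> are known to lie in \<open>E\<close>.
  So this last coefficient is a limit of elements of \<open>E\<close>, and \<open>E\<close> is closed.

  The two remainder estimates, \<open>peano_taylor\<close> and \<open>smooth_map_increment_little_o\<close>, rest on
  the mean value theorem in the form \<open>mean_value_convex\<close>: if the derivative of a curve takes its
  values in an open convex set, then so do its difference quotients. This is enough to estimate
  limits because the convex open sets form a basis of neighbourhoods of \<open>0\<close>.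
\<close>

section \<open>Limits in locally convex spaces\<close>

lemma tendsto_frechet_scaleR:
  fixes g :: "'b \<Rightarrow> 'a::frechet_space"
  assumes "(r \<longlongrightarrow> a) F" and "(g \<longlongrightarrow> x) F"
  shows "((\<lambda>t. r t *\<^sub>R g t) \<longlongrightarrow> a *\<^sub>R x) F"
proof -
  have "filterlim (\<lambda>t. (r t, g t)) (nhds a \<times>\<^sub>F nhds x) F"
    using assms by (rule filterlim_Pair)
  from filterlim_compose[OF tendsto_scaleR_Pair this] show ?thesis by simp
qed

lemma tendsto_zero_if_eventually_in_convex:
  fixes g :: "'b \<Rightarrow> 'a::frechet_space"
  assumes "\<And>C. open C \<Longrightarrow> convex C \<Longrightarrow> 0 \<in> C \<Longrightarrow> eventually (\<lambda>t. g t \<in> C) F"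
  shows "(g \<longlongrightarrow> 0) F"
proof (rule topological_tendstoI)
  fix S :: "'a set" assume "open S" "0 \<in> S"
  then obtain C where C: "open C" "convex C" "0 \<in> C" "C \<subseteq> S"
    using frechet_locally_convex by blast
  show "eventually (\<lambda>t. g t \<in> S) F"
    using assms[OF C(1-3)] by eventually_elim (use C in auto)
qed

lemma convex_scale_mem:
  assumes "convex C" and "0 \<in> C" and "x \<in> C" and "0 \<le> u" and "u \<le> 1"
  shows "u *\<^sub>R x \<in> C"
  using convexD[OF assms(1,3,2), of u "1 - u"] assms by simp

section \<open>Directional derivatives\<close>

lemma dir_deriv_eq:
  assumes "has_dir_deriv P x v d"
  shows "dir_deriv P x v = d"
  unfolding dir_deriv_def
proof (rule the_equality, rule assms)
  show "e = d" if "has_dir_deriv P x v e" for e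
    using that assms unfolding has_dir_deriv_def
    by (rule tendsto_unique[OF trivial_limit_at])
qed

lemma has_dir_deriv_zero: "has_dir_deriv P x 0 0"
  by (simp add: has_dir_deriv_def)

lemma has_dir_deriv_along_line:
  assumes "has_dir_deriv P (x + u *\<^sub>R v) v d"
  shows "has_dir_deriv (\<lambda>u. P (x + u *\<^sub>R v)) u 1 d"
  using assms by (simp add: has_dir_deriv_def scaleR_add_left add.assoc)

lemma has_dir_deriv_diff:
  assumes "has_dir_deriv g t v d" and "has_dir_deriv h t v e"
  shows "has_dir_deriv (\<lambda>t. g t - h t) t v (d - e)"
  using tendsto_diff[OF assms[unfolded has_dir_deriv_def]]
  by (simp add: has_dir_deriv_def algebra_simps)

lemma has_dir_deriv_sum:
  assumes "\<And>i. i \<in> I \<Longrightarrow> has_dir_deriv (g i) t v (d i)"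
  shows "has_dir_deriv (\<lambda>t. \<Sum>i\<in>I. g i t) t v (\<Sum>i\<in>I. d i)"
  using tendsto_sum[of I "\<lambda>i s. (1 / s) *\<^sub>R (g i (t + s *\<^sub>R v) - g i t)" d "at 0"] assms
  by (simp add: has_dir_deriv_def scaleR_sum_right sum_subtractf[symmetric])

lemma has_dir_deriv_scaleR_const:
  assumes "has_dir_deriv g t v d"
  shows "has_dir_deriv (\<lambda>t. a *\<^sub>R g t) t v (a *\<^sub>R d)"
  using tendsto_frechet_scaleR[OF tendsto_const[of a] assms[unfolded has_dir_deriv_def]]
  by (simp add: has_dir_deriv_def scaleR_diff_right mult.commute)

lemma has_dir_deriv_real_scaleR:
  assumes "(\<phi> has_real_derivative m) (at t)"
  shows "has_dir_deriv (\<lambda>t. \<phi> t *\<^sub>R a) t 1 (m *\<^sub>R a)"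
  using tendsto_frechet_scaleR[OF assms[unfolded DERIV_def] tendsto_const[of a]]
  by (simp add: has_dir_deriv_def scaleR_diff_left scaleR_diff_right diff_divide_distrib)

lemma has_dir_deriv_imp_tendsto:
  fixes g :: "real \<Rightarrow> 'a::frechet_space"
  assumes "has_dir_deriv g 0 1 d"
  shows "(g \<longlongrightarrow> g 0) (at 0)"
proof -
  have "((\<lambda>t. t *\<^sub>R ((1 / t) *\<^sub>R (g (0 + t *\<^sub>R 1) - g 0)) + g 0) \<longlongrightarrow> 0 *\<^sub>R d + g 0) (at 0)"
    using assms unfolding has_dir_deriv_def
    by (intro tendsto_add tendsto_const tendsto_frechet_scaleR tendsto_ident_at)
  then have "((\<lambda>t. t *\<^sub>R ((1 / t) *\<^sub>R (g (0 + t *\<^sub>R 1) - g 0)) + g 0) \<longlongrightarrow> g 0) (at 0)"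
    by simp
  then show ?thesis
    by (rule Lim_transform_eventually) (simp add: eventually_at_filter)
qed

section \<open>The mean value theorem with values in a convex set\<close>

lemma difference_quotients_near:
  fixes g :: "real \<Rightarrow> 'a::frechet_space"
  assumes "has_dir_deriv g x 1 d" and "d \<in> C" and "open C"
  shows "\<exists>\<delta>>0. \<forall>y. \<bar>y - x\<bar> < \<delta> \<longrightarrow> (\<exists>z\<in>C. g y - g x = (y - x) *\<^sub>R z)"
proof -
  have "eventually (\<lambda>t. (1 / t) *\<^sub>R (g (x + t *\<^sub>R 1) - g x) \<in> C) (at 0)"
    using assms topological_tendstoD unfolding has_dir_deriv_def by blast
  then obtain \<delta> where "\<delta> > 0"
    and \<delta>: "\<And>t. t \<noteq> 0 \<Longrightarrow> \<bar>t\<bar> < \<delta> \<Longrightarrow> (1 / t) *\<^sub>R (g (x + t) - g x) \<in> C"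
    by (auto simp: eventually_at dist_real_def)
  have "\<exists>z\<in>C. g y - g x = (y - x) *\<^sub>R z" if "\<bar>y - x\<bar> < \<delta>" for y
  proof (cases "y = x")
    case True
    then show ?thesis using assms(2) by auto
  next
    case False
    then show ?thesis using \<delta>[of "y - x"] that
      by (intro bexI[of _ "(1 / (y - x)) *\<^sub>R (g y - g x)"]) auto
  qed
  with \<open>\<delta> > 0\<close> show ?thesis by blast
qed

text \<open>
  The slope of a chord composed of two consecutive chords is a convex combination of their slopes.
\<close>

lemma convex_combine_increments:
  fixes a b c :: real
  assumes "convex C" and "y \<in> C" and "z \<in> C" and "a \<le> b" and "b \<le> c"
  shows "\<exists>w\<in>C. (b - a) *\<^sub>R y + (c - b) *\<^sub>R z = (c - a) *\<^sub>R w"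
proof (cases "a = c")
  case True
  then show ?thesis using assms by auto
next
  case False
  then have "c - a > 0" using assms by simp
  then have "((b - a) / (c - a)) *\<^sub>R y + ((c - b) / (c - a)) *\<^sub>R z \<in> C"
    using assms by (intro convexD) (auto simp: add_divide_distrib[symmetric])
  then show ?thesis
    using \<open>c - a > 0\<close> by (intro bexI) (auto simp: scaleR_add_right)
qed

text \<open>
  Having a slope in \<open>C\<close> passes from two adjacent intervals to their union because \<open>C\<close> is convex,
  and it holds for all short intervals around a given point because \<open>C\<close> is open and contains
  the derivative there. By bisection it then holds for \<open>[a, b]\<close>. Slopes are multiplied out, so that
  degenerate intervals, where any element of \<open>C\<close> will do, need no separate treatment.
\<close>

lemma mean_value_convex_le:
  fixes g :: "real \<Rightarrow> 'a::frechet_space"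
  assumes C: "open C" "convex C" and "a \<le> b"
    and deriv: "\<And>u. a \<le> u \<Longrightarrow> u \<le> b \<Longrightarrow> \<exists>d\<in>C. has_dir_deriv g u 1 d"
  shows "\<exists>y\<in>C. g b - g a = (b - a) *\<^sub>R y"
  using \<open>a \<le> b\<close>
proof (induction rule: Bolzano)
  case (trans r s t)
  then obtain y z where yz: "y \<in> C" "z \<in> C" "g s - g r = (s - r) *\<^sub>R y" "g t - g s = (t - s) *\<^sub>R z"
    by blast
  obtain w where "w \<in> C" "(s - r) *\<^sub>R y + (t - s) *\<^sub>R z = (t - r) *\<^sub>R w"
    using convex_combine_increments[OF C(2) yz(1,2)] trans by blast
  moreover have "g t - g r = (g s - g r) + (g t - g s)" by simp
  ultimately show ?case using yz by metis
next
  case (local x)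
  obtain d where "d \<in> C" "has_dir_deriv g x 1 d"
    using deriv local by blast
  then obtain \<delta> where "\<delta> > 0"
    and \<delta>: "\<And>y. \<bar>y - x\<bar> < \<delta> \<Longrightarrow> \<exists>z\<in>C. g y - g x = (y - x) *\<^sub>R z"
    using difference_quotients_near C(1) by blast
  have "\<exists>w\<in>C. g t - g r = (t - r) *\<^sub>R w" if "r \<le> x" "x \<le> t" "t - r < \<delta>" for r t
  proof -
    have near: "\<bar>r - x\<bar> < \<delta>" "\<bar>t - x\<bar> < \<delta>" using that by auto
    obtain y z where yz: "y \<in> C" "g r - g x = (r - x) *\<^sub>R y" "z \<in> C" "g t - g x = (t - x) *\<^sub>R z"
      using \<delta>[OF near(1)] \<delta>[OF near(2)] by blast
    have "g t - g r = (g t - g x) - (g r - g x)" by simp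
    also have "\<dots> = (x - r) *\<^sub>R y + (t - x) *\<^sub>R z"
      unfolding yz by (simp add: algebra_simps)
    finally show ?thesis
      using convex_combine_increments[OF C(2) yz(1,3)] that by metis
  qed
  then show ?case using \<open>\<delta> > 0\<close> by blast
qed

text \<open>
  Writing the points between \<open>0\<close> and \<open>s\<close> as \<open>\<theta> s\<close> covers both signs of \<open>s\<close>.
\<close>

lemma mean_value_convex:
  fixes g :: "real \<Rightarrow> 'a::frechet_space"
  assumes C: "open C" "convex C" and "s \<noteq> 0"
    and deriv: "\<And>\<theta>. 0 \<le> \<theta> \<Longrightarrow> \<theta> \<le> 1 \<Longrightarrow> \<exists>d\<in>C. has_dir_deriv g (\<theta> * s) 1 d"
  shows "(1 / s) *\<^sub>R (g s - g 0) \<in> C"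
proof -
  have deriv': "\<exists>d\<in>C. has_dir_deriv g u 1 d" if "0 \<le> u / s" "u / s \<le> 1" for u
    using deriv[OF that] \<open>s \<noteq> 0\<close> by simp
  have "\<exists>y\<in>C. g s - g 0 = s *\<^sub>R y"
  proof (cases "s > 0")
    case True
    then show ?thesis
      using mean_value_convex_le[OF C, of 0 s g] deriv' by auto
  next
    case False
    then have "s < 0" using \<open>s \<noteq> 0\<close> by simp
    then have "\<exists>y\<in>C. g 0 - g s = (0 - s) *\<^sub>R y"
      by (intro mean_value_convex_le[OF C] deriv') (auto simp: divide_simps)
    then obtain y where y: "y \<in> C" "g 0 - g s = (0 - s) *\<^sub>R y" by blast
    have "g s - g 0 = - (g 0 - g s)" by simp
    also have "\<dots> = s *\<^sub>R y" unfolding y(2) by simp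
    finally show ?thesis using y(1) by blast
  qed
  then obtain y where y: "y \<in> C" "g s - g 0 = s *\<^sub>R y" by blast
  then have "(1 / s) *\<^sub>R (g s - g 0) = y" using \<open>s \<noteq> 0\<close> by (simp only: y) simp
  with y(1) show ?thesis by (simp only:)
qed

section \<open>Taylor polynomials of curves\<close>

text \<open>
  The derivative of the rescaled curve \<open>u \<mapsto> g(u) / t\<^sup>n\<close> at \<open>u = \<theta> t\<close> is \<open>\<theta>\<^sup>n\<close> times
  \<open>h(u) / u\<^sup>n\<close>. For small \<open>t\<close> the latter lies in a given convex neighbourhood \<open>C\<close> of \<open>0\<close>, and
  shrinking by \<open>\<theta>\<^sup>n \<in> [0, 1]\<close> does not leave \<open>C\<close>. The mean value theorem on the segment
  from \<open>0\<close> to \<open>t\<close> concludes.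
\<close>

lemma integrate_little_o_power:
  fixes g h :: "real \<Rightarrow> 'a::frechet_space"
  assumes "\<delta> > 0" and deriv: "\<And>t. \<bar>t\<bar> < \<delta> \<Longrightarrow> has_dir_deriv g t 1 (h t)"
    and "g 0 = 0" and "h 0 = 0"
    and lim: "((\<lambda>t. (1 / t ^ n) *\<^sub>R h t) \<longlongrightarrow> 0) (at 0)"
  shows "((\<lambda>t. (1 / t ^ Suc n) *\<^sub>R g t) \<longlongrightarrow> 0) (at 0)"
proof (rule tendsto_zero_if_eventually_in_convex)
  fix C :: "'a set" assume C: "open C" "convex C" "0 \<in> C"
  have "eventually (\<lambda>t. (1 / t ^ n) *\<^sub>R h t \<in> C) (at 0)"
    using topological_tendstoD[OF lim] C by blast
  then obtain \<eta> where "\<eta> > 0"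
    and \<eta>: "\<And>t. t \<noteq> 0 \<Longrightarrow> \<bar>t\<bar> < \<eta> \<Longrightarrow> (1 / t ^ n) *\<^sub>R h t \<in> C"
    by (auto simp: eventually_at dist_real_def)
  have "(1 / t ^ Suc n) *\<^sub>R g t \<in> C" if t: "t \<noteq> 0" "\<bar>t\<bar> < min \<delta> \<eta>" for t
  proof -
    have "\<exists>d\<in>C. has_dir_deriv (\<lambda>u. (1 / t ^ n) *\<^sub>R g u) (\<theta> * t) 1 d"
      if \<theta>: "0 \<le> \<theta>" "\<theta> \<le> 1" for \<theta>
    proof
      have "\<bar>\<theta> * t\<bar> \<le> \<bar>t\<bar>"
        using \<theta> by (simp add: abs_mult mult_left_le_one_le)
      then have small: "\<bar>\<theta> * t\<bar> < \<delta>" "\<bar>\<theta> * t\<bar> < \<eta>" using t by auto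
      show "has_dir_deriv (\<lambda>u. (1 / t ^ n) *\<^sub>R g u) (\<theta> * t) 1 ((1 / t ^ n) *\<^sub>R h (\<theta> * t))"
        by (intro has_dir_deriv_scaleR_const deriv small)
      show "(1 / t ^ n) *\<^sub>R h (\<theta> * t) \<in> C"
      \<comment> \<open>The limit says nothing about \<open>h\<close> at \<open>0\<close> itself.\<close>
      proof (cases "\<theta> = 0")
        case True
        then show ?thesis using C \<open>h 0 = 0\<close> by simp
      next
        case False
        then have "\<theta> ^ n *\<^sub>R ((1 / (\<theta> * t) ^ n) *\<^sub>R h (\<theta> * t)) \<in> C"
          using \<theta> t small by (intro convex_scale_mem C \<eta>) (auto simp: power_le_one)
        then show ?thesis using False by (simp add: power_mult_distrib)
      qed
    qed
    from mean_value_convex[OF C(1,2) t(1) this] show ?thesis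
      using \<open>g 0 = 0\<close> by (simp add: mult.commute)
  qed
  then show "eventually (\<lambda>t. (1 / t ^ Suc n) *\<^sub>R g t \<in> C) (at 0)"
    using \<open>\<delta> > 0\<close> \<open>\<eta> > 0\<close> unfolding eventually_at
    by (intro exI[of _ "min \<delta> \<eta>"]) (auto simp: dist_real_def)
qed

definition taylor_poly :: "(nat \<Rightarrow> 'a::real_vector) \<Rightarrow> nat \<Rightarrow> real \<Rightarrow> 'a" where
  "taylor_poly a n t = (\<Sum>j\<le>n. (t ^ j / fact j) *\<^sub>R a j)"

lemma taylor_poly_at_0: "taylor_poly a n 0 = a 0"
proof -
  have "taylor_poly a n 0 = (\<Sum>j\<le>n. if j = 0 then a 0 else 0)"
    unfolding taylor_poly_def by (intro sum.cong) auto
  then show ?thesis by simp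
qed

lemma has_dir_deriv_taylor_poly:
  fixes a :: "nat \<Rightarrow> 'a::frechet_space"
  shows "has_dir_deriv (taylor_poly a (Suc n)) t 1 (taylor_poly (\<lambda>j. a (Suc j)) n t)"
proof -
  have "has_dir_deriv (\<lambda>t. \<Sum>j\<le>Suc n. (t ^ j / fact j) *\<^sub>R a j) t 1
      (\<Sum>j\<le>Suc n. (real j * t ^ (j - 1) / fact j) *\<^sub>R a j)"
    by (intro has_dir_deriv_sum has_dir_deriv_real_scaleR) (auto intro!: derivative_eq_intros)
  also have "(\<Sum>j\<le>Suc n. (real j * t ^ (j - 1) / fact j) *\<^sub>R a j) = taylor_poly (\<lambda>j. a (Suc j)) n t"
    unfolding taylor_poly_def sum.atMost_Suc_shift
    by (simp del: of_nat_Suc add: fact_Suc)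
  finally show ?thesis by (simp add: taylor_poly_def[abs_def])
qed

lemma taylor_poly_tendsto:
  fixes a :: "nat \<Rightarrow> 'a::frechet_space"
  shows "(taylor_poly a n \<longlongrightarrow> a 0) (at 0)"
proof -
  have "((\<lambda>t. \<Sum>j\<le>n. (t ^ j / fact j) *\<^sub>R a j) \<longlongrightarrow> (\<Sum>j\<le>n. (0 ^ j / fact j) *\<^sub>R a j)) (at 0)"
    by (intro tendsto_sum tendsto_frechet_scaleR tendsto_intros) auto
  then show ?thesis
    using taylor_poly_at_0[of a n] by (simp add: taylor_poly_def[abs_def])
qed

text \<open>
  The remainder of order \<open>n + 1\<close> of \<open>D k\<close> vanishes at \<open>0\<close>, and its derivative is the remainder
  of order \<open>n\<close> of \<open>D (Suc k)\<close>, so induction on \<open>n\<close> for all \<open>k\<close> at once gains one power of \<open>t\<close>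
  per step.
\<close>

lemma peano_taylor:
  fixes D :: "nat \<Rightarrow> real \<Rightarrow> 'a::frechet_space"
  assumes "\<delta> > 0" and deriv: "\<And>k t. \<bar>t\<bar> < \<delta> \<Longrightarrow> has_dir_deriv (D k) t 1 (D (Suc k) t)"
  shows "((\<lambda>t. (1 / t ^ n) *\<^sub>R (D k t - taylor_poly (\<lambda>j. D (k + j) 0) n t)) \<longlongrightarrow> 0) (at 0)"
proof (induction n arbitrary: k)
  case 0
  have "(D k \<longlongrightarrow> D k 0) (at 0)"
    using deriv[of 0] \<open>\<delta> > 0\<close> by (intro has_dir_deriv_imp_tendsto) auto
  from tendsto_diff[OF this tendsto_const[of "D k 0"]] show ?case
    by (simp add: taylor_poly_def)
next
  case (Suc n)
  have shift: "(\<lambda>j. D (Suc k + j) 0) = (\<lambda>j. D (k + Suc j) 0)" by simp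
  show ?case
  proof (rule integrate_little_o_power[OF \<open>\<delta> > 0\<close>])
    show "has_dir_deriv (\<lambda>t. D k t - taylor_poly (\<lambda>j. D (k + j) 0) (Suc n) t) t 1
        (D (Suc k) t - taylor_poly (\<lambda>j. D (Suc k + j) 0) n t)" if "\<bar>t\<bar> < \<delta>" for t
      unfolding shift by (intro has_dir_deriv_diff has_dir_deriv_taylor_poly deriv that)
    show "((\<lambda>t. (1 / t ^ n) *\<^sub>R (D (Suc k) t - taylor_poly (\<lambda>j. D (Suc k + j) 0) n t)) \<longlongrightarrow> 0) (at 0)"
      by (rule Suc.IH)
  qed (simp_all add: taylor_poly_at_0)
qed

section \<open>Smooth maps\<close>

lemma smooth_map_on_has_dir_deriv:
  assumes "smooth_map_on U P" and "x \<in> U"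
  shows "has_dir_deriv P x v (dir_deriv P x v)"
proof -
  have "Ck_on (Suc 0) U P" using assms(1) unfolding smooth_map_on_def by (rule spec)
  then have "\<forall>f\<in>U. \<forall>v. \<exists>d. has_dir_deriv P f (v (0::nat)) d"
    unfolding Ck_on.simps iter_deriv.simps by blast
  from spec[OF bspec[OF this assms(2)], of "\<lambda>_. v"]
  obtain d where d: "has_dir_deriv P x v d" by blast
  then show ?thesis using dir_deriv_eq[OF d] by simp
qed

text \<open>
  A direction is turned into the extensional \<open>1\<close>-tuple that the definition of \<open>C\<^sup>1\<close> maps asks for.
\<close>

lemma smooth_map_on_continuous_dir_deriv:
  assumes "smooth_map_on U P"
  shows "continuous_on (U \<times> UNIV) (\<lambda>(x, v). dir_deriv P x v)"
proof -
  let ?T = "top_of_set (U \<times> (UNIV :: 'a set))"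
  have "Ck_on (Suc 0) U P" using assms unfolding smooth_map_on_def by (rule spec)
  then have "continuous_map
      (prod_topology (top_of_set U) (product_topology (\<lambda>_. euclidean) {..<Suc 0})) euclidean
      (\<lambda>(x, v). dir_deriv P x (v 0))"
    by (simp only: Ck_on.simps iter_deriv.simps)
  moreover have "continuous_map ?T
      (prod_topology (top_of_set U) (product_topology (\<lambda>_. euclidean) {..<Suc 0}))
      (\<lambda>q. (fst q, restrict (\<lambda>_. snd q) {..<Suc 0}))"
    by (intro continuous_map_pairedI)
      (auto simp: continuous_map_componentwise continuous_map_in_subtopology
        intro!: continuous_intros)
  ultimately have "continuous_map ?T euclidean
      ((\<lambda>(x, v). dir_deriv P x (v 0)) \<circ> (\<lambda>q. (fst q, restrict (\<lambda>_. snd q) {..<Suc 0})))"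
    by (rule continuous_map_compose[rotated])
  then show ?thesis by (simp add: o_def split_def)
qed

text \<open>
  The iterated derivative of a curve is its iterated directional derivative with all directions
  equal to \<open>1\<close>.
\<close>

lemma smooth_curve_iterated_deriv:
  fixes c :: "real \<Rightarrow> 'a::frechet_space"
  assumes "smooth_map_on S c" and "t \<in> S"
  shows "has_dir_deriv ((curve_deriv ^^ k) c) t 1 ((curve_deriv ^^ Suc k) c t)"
proof -
  have iter: "(\<lambda>s. iter_deriv k c s (\<lambda>_. 1)) = (curve_deriv ^^ k) c" for k
    by (induction k) (auto simp: curve_deriv_def fun_eq_iff)
  have "Ck_on (Suc k) S c" using assms(1) unfolding smooth_map_on_def by (rule spec)
  then obtain d where "has_dir_deriv (\<lambda>s. iter_deriv k c s (\<lambda>_. 1)) t ((\<lambda>_. 1) k) d"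
    using \<open>t \<in> S\<close> by (simp only: Ck_on.simps) blast
  then have d: "has_dir_deriv ((curve_deriv ^^ k) c) t 1 d" by (simp add: iter)
  then show ?thesis using dir_deriv_eq[OF d] by (simp add: curve_deriv_def)
qed

text \<open>
  The difference quotient is the slope of the curve \<open>u \<mapsto> P (p + u w)\<close> between \<open>0\<close> and \<open>s\<close>, whose
  derivative is \<open>DP(p + u w) w\<close>. This is close to \<open>DP(x) 0 = 0\<close>, as \<open>DP\<close> is jointly
  continuous, \<open>w\<close> is small, and the segment from \<open>p\<close> to \<open>p + s w\<close> stays in a convex neighbourhood of
  \<open>x\<close>. The scale \<open>s\<close> is arbitrary as long as both ends of the segment tend to \<open>x\<close>; below it is
  \<open>t\<^sup>n\<close>, which is constant for \<open>n = 0\<close>.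
\<close>

lemma smooth_map_increment_little_o:
  fixes P :: "'a::frechet_space \<Rightarrow> 'b::frechet_space"
  assumes "open U" and "smooth_map_on U P" and "x \<in> U"
    and p: "(p \<longlongrightarrow> x) F" and w: "(w \<longlongrightarrow> 0) F"
    and q: "((\<lambda>t. p t + s t *\<^sub>R w t) \<longlongrightarrow> x) F"
    and "eventually (\<lambda>t. s t \<noteq> 0) F"
  shows "((\<lambda>t. (1 / s t) *\<^sub>R (P (p t + s t *\<^sub>R w t) - P (p t))) \<longlongrightarrow> 0) F"
proof (rule tendsto_zero_if_eventually_in_convex)
  fix C :: "'b set" assume C: "open C" "convex C" "0 \<in> C"
  let ?D = "\<lambda>(y, v). dir_deriv P y v"
  have "open (?D -` C \<inter> U \<times> UNIV)"
    using continuous_on_open_vimage[of "U \<times> UNIV" ?D]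
      smooth_map_on_continuous_dir_deriv[OF assms(2)] C(1) \<open>open U\<close>
    by (auto simp: open_Times)
  moreover have "(x, 0) \<in> ?D -` C \<inter> U \<times> UNIV"
    using C(3) \<open>x \<in> U\<close> by (simp add: dir_deriv_eq[OF has_dir_deriv_zero])
  ultimately obtain A B where AB: "open A" "x \<in> A" "open B" "0 \<in> B"
    and sub: "A \<times> B \<subseteq> ?D -` C \<inter> U \<times> UNIV"
    by (rule open_prod_elim) auto
  have "open ((\<lambda>y. x + y) -` A)"
    by (intro open_vimage AB continuous_intros)
  then obtain V where V: "open V" "convex V" "0 \<in> V" "V \<subseteq> (\<lambda>y. x + y) -` A"
    using frechet_locally_convex[of "(\<lambda>y. x + y) -` A"] AB by auto
  have near: "eventually (\<lambda>t. r t - x \<in> V) F" if "(r \<longlongrightarrow> x) F" for r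
    using topological_tendstoD[OF tendsto_diff[OF that tendsto_const[of x]], of V] V by simp
  have "eventually (\<lambda>t. w t \<in> B) F"
    using topological_tendstoD[OF w] AB by blast
  with near[OF p] near[OF q] \<open>eventually (\<lambda>t. s t \<noteq> 0) F\<close>
  show "eventually (\<lambda>t. (1 / s t) *\<^sub>R (P (p t + s t *\<^sub>R w t) - P (p t)) \<in> C) F"
  proof eventually_elim
    case (elim t)
    have "\<exists>d\<in>C. has_dir_deriv (\<lambda>u. P (p t + u *\<^sub>R w t)) (\<theta> * s t) 1 d"
      if \<theta>: "0 \<le> \<theta>" "\<theta> \<le> 1" for \<theta>
    proof -
      let ?y = "p t + (\<theta> * s t) *\<^sub>R w t"
      have "(1 - \<theta>) *\<^sub>R (p t - x) + \<theta> *\<^sub>R (p t + s t *\<^sub>R w t - x) \<in> V"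
        using elim \<theta> by (intro convexD[OF V(2)]) auto
      also have "(1 - \<theta>) *\<^sub>R (p t - x) + \<theta> *\<^sub>R (p t + s t *\<^sub>R w t - x) = ?y - x"
        by (simp add: algebra_simps)
      finally have "?y \<in> A" using V(4) by auto
      then have "?y \<in> U" "dir_deriv P ?y (w t) \<in> C" using sub elim by auto
      then show ?thesis
        using has_dir_deriv_along_line[OF smooth_map_on_has_dir_deriv[OF assms(2)]] by blast
    qed
    from mean_value_convex[OF C(1,2) elim(3) this] show ?case by simp
  qed
qed

section \<open>Integral curves and invariant subspaces\<close>

text \<open>
  Here \<open>D k\<close> is the \<open>k\<close>-th derivative of the integral curve \<open>D 0\<close>. In the proof, \<open>?w\<close> and \<open>?R\<close>
  are the rescaled Taylor remainders of \<open>D 0\<close> and \<open>D 1\<close>, and \<open>?low\<close> is the part of the Taylor polynomial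
  of \<open>D 1\<close> whose coefficients lie in \<open>E\<close> by induction. Replacing \<open>D 1\<close>, which equals
  \<open>X \<circ> D 0\<close>, by \<open>X \<circ> ?p\<close> costs only \<open>o(t\<^sup>n)\<close>, so \<open>?e\<close>, which takes its values in \<open>E\<close>, tends to
  the remaining coefficient \<open>D (Suc n) 0 / n!\<close>.
\<close>

lemma integral_curve_derivatives_in_subspace:
  fixes E U :: "'a::frechet_space set" and D :: "nat \<Rightarrow> real \<Rightarrow> 'a"
  assumes E: "subspace E" "closed E" and X: "open U" "smooth_map_on U X"
    and inv: "X ` (U \<inter> (+) f ` E) \<subseteq> E"
    and "\<delta> > 0" and deriv: "\<And>k t. \<bar>t\<bar> < \<delta> \<Longrightarrow> has_dir_deriv (D k) t 1 (D (Suc k) t)"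
    and start: "D 0 0 \<in> U \<inter> (+) f ` E"
    and ode: "\<And>t. \<bar>t\<bar> < \<delta> \<Longrightarrow> X (D 0 t) = D 1 t"
  shows "D (Suc n) 0 \<in> E"
proof (induction n rule: less_induct)
  case (less n)
  let ?p = "taylor_poly (\<lambda>j. D j 0) n"
  let ?w = "\<lambda>t. (1 / t ^ n) *\<^sub>R (D 0 t - ?p t)"
  let ?R = "\<lambda>t. (1 / t ^ n) *\<^sub>R (D 1 t - taylor_poly (\<lambda>j. D (Suc j) 0) n t)"
  let ?low = "\<lambda>t. \<Sum>j<n. (t ^ j / fact j) *\<^sub>R D (Suc j) 0"
  let ?e = "\<lambda>t. (1 / t ^ n) *\<^sub>R (X (?p t) - ?low t)"
  have D0: "(D 0 \<longlongrightarrow> D 0 0) (at 0)"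
    using deriv[of 0] \<open>\<delta> > 0\<close> by (intro has_dir_deriv_imp_tendsto) auto
  have p: "(?p \<longlongrightarrow> D 0 0) (at 0)" by (rule taylor_poly_tendsto)
  have w: "(?w \<longlongrightarrow> 0) (at 0)"
    using peano_taylor[of \<delta> D n 0, OF \<open>\<delta> > 0\<close> deriv] by simp
  have R: "(?R \<longlongrightarrow> 0) (at 0)"
    using peano_taylor[of \<delta> D n 1, OF \<open>\<delta> > 0\<close> deriv] by simp
  have nonzero: "eventually (\<lambda>t::real. t \<noteq> 0) (at 0)"
    by (simp add: eventually_at_filter)
  have small: "eventually (\<lambda>t::real. \<bar>t\<bar> < \<delta>) (at 0)"
    using \<open>\<delta> > 0\<close> by (auto simp: eventually_at dist_real_def)
  have "((\<lambda>t. ?p t + t ^ n *\<^sub>R ?w t) \<longlongrightarrow> D 0 0) (at 0)"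
    by (rule Lim_transform_eventually[OF D0]) (use nonzero in eventually_elim, simp)
  then have "((\<lambda>t. (1 / t ^ n) *\<^sub>R (X (?p t + t ^ n *\<^sub>R ?w t) - X (?p t))) \<longlongrightarrow> 0) (at 0)"
  proof (rule smooth_map_increment_little_o[OF X _ p w, rotated])
    show "D 0 0 \<in> U" using start by blast
    show "eventually (\<lambda>t::real. t ^ n \<noteq> 0) (at 0)"
      using nonzero by eventually_elim simp
  qed
  from tendsto_diff[OF R this]
  have "((\<lambda>t. ?R t - (1 / t ^ n) *\<^sub>R (X (?p t + t ^ n *\<^sub>R ?w t) - X (?p t))) \<longlongrightarrow> 0) (at 0)"
    by simp
  then have "((\<lambda>t. ?e t - (1 / fact n) *\<^sub>R D (Suc n) 0) \<longlongrightarrow> 0) (at 0)"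
  proof (rule Lim_transform_eventually)
    show "eventually (\<lambda>t. ?R t - (1 / t ^ n) *\<^sub>R (X (?p t + t ^ n *\<^sub>R ?w t) - X (?p t)) =
        ?e t - (1 / fact n) *\<^sub>R D (Suc n) 0) (at 0)"
      using nonzero small
    proof eventually_elim
      case (elim t)
      have "X (?p t + t ^ n *\<^sub>R ?w t) = D 1 t"
        using elim ode[of t] by simp
      moreover have "taylor_poly (\<lambda>j. D (Suc j) 0) n t = ?low t + (t ^ n / fact n) *\<^sub>R D (Suc n) 0"
        by (simp add: taylor_poly_def lessThan_Suc_atMost[symmetric])
      ultimately show ?case
        using elim by (simp add: algebra_simps)
    qed
  qed
  from tendsto_add[OF this tendsto_const[of "(1 / fact n) *\<^sub>R D (Suc n) 0"]]
  have lim: "(?e \<longlongrightarrow> (1 / fact n) *\<^sub>R D (Suc n) 0) (at 0)" by simp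
  have p_in: "?p t \<in> (+) f ` E" for t
  proof -
    obtain e where e: "e \<in> E" "D 0 0 = f + e" using start by blast
    have "?p t = D 0 0 + (\<Sum>j<n. (t ^ Suc j / fact (Suc j)) *\<^sub>R D (Suc j) 0)"
      unfolding taylor_poly_def by (subst sum.atMost_shift) simp
    also have "\<dots> = f + (e + (\<Sum>j<n. (t ^ Suc j / fact (Suc j)) *\<^sub>R D (Suc j) 0))"
      by (simp add: e add.assoc)
    finally have eq: "?p t = \<dots>" .
    have "e + (\<Sum>j<n. (t ^ Suc j / fact (Suc j)) *\<^sub>R D (Suc j) 0) \<in> E"
      using e less.IH by (intro subspace_add subspace_sum subspace_scale E) auto
    then show ?thesis using eq by blast
  qed
  have "eventually (\<lambda>t. ?p t \<in> U) (at 0)"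
    using topological_tendstoD[OF p] X(1) start by blast
  then have "eventually (\<lambda>t. ?e t \<in> E) (at 0)"
  proof eventually_elim
    case (elim t)
    then have "X (?p t) \<in> E" using inv p_in by blast
    then show ?case
      using less.IH by (intro subspace_scale subspace_diff subspace_sum E) auto
  qed
  then have "(1 / fact n) *\<^sub>R D (Suc n) 0 \<in> E"
    using Lim_in_closed_set[OF E(2) _ _ lim] by simp
  from subspace_scale[OF E(1) this, of "fact n"] show ?case by simp
qed

theorem corollary2p5:
  fixes E U :: "'a::frechet_space set"
    and X :: "'a \<Rightarrow> 'a" and f :: 'a and c :: "real \<Rightarrow> 'a" and \<epsilon> :: real
  assumes "subspace E" and "closed E"
    and "open U" and "smooth_map_on U X"
    and "X ` (U \<inter> (+) f ` E) \<subseteq> E"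
    and "\<epsilon> > 0" and "smooth_map_on {-\<epsilon><..<\<epsilon>} c"
    and "c 0 \<in> U \<inter> (+) f ` E"
    and "\<And>t. t \<in> {-\<epsilon><..<\<epsilon>} \<Longrightarrow> c t \<in> U \<and> X (c t) = curve_deriv c t"
    and "\<And>t. t \<in> {-\<epsilon><..<\<epsilon>} \<Longrightarrow>
           (\<lambda>k. (t ^ k / fact k) *\<^sub>R (curve_deriv ^^ k) c 0) sums c t"
  shows "\<forall>t\<in>{-\<epsilon><..<\<epsilon>}. c t - c 0 \<in> E"
proof
  fix t assume t: "t \<in> {-\<epsilon><..<\<epsilon>}"
  let ?D = "\<lambda>k. (curve_deriv ^^ k) c"
  let ?a = "\<lambda>k. (t ^ k / fact k) *\<^sub>R ?D k 0"
  have in_E: "?D (Suc n) 0 \<in> E" for n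
  proof (rule integral_curve_derivatives_in_subspace[where D = ?D, OF assms(1-6)])
    show "has_dir_deriv (?D k) s 1 (?D (Suc k) s)" if "\<bar>s\<bar> < \<epsilon>" for k s
      using that by (intro smooth_curve_iterated_deriv[OF assms(7)]) auto
    show "?D 0 0 \<in> U \<inter> (+) f ` E" using assms(8) by simp
    show "X (?D 0 s) = ?D 1 s" if "\<bar>s\<bar> < \<epsilon>" for s
    proof -
      have "s \<in> {-\<epsilon><..<\<epsilon>}" using that by auto
      from assms(9)[OF this] show ?thesis by (simp add: curve_deriv_def)
    qed
  qed
  have "(\<lambda>n. \<Sum>k<Suc n. ?a k) \<longlonglongrightarrow> c t"
    using assms(10)[OF t] unfolding sums_def by (rule LIMSEQ_Suc)
  from tendsto_diff[OF this tendsto_const[of "c 0"]]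
  have lim: "(\<lambda>n. \<Sum>k<n. ?a (Suc k)) \<longlonglongrightarrow> c t - c 0"
    by (simp only: sum.lessThan_Suc_shift) simp
  have "(\<Sum>k<n. ?a (Suc k)) \<in> E" for n
    by (intro subspace_sum subspace_scale assms(1) in_E)
  then show "c t - c 0 \<in> E"
    using Lim_in_closed_set[OF assms(2) _ _ lim] by simp
qed

end
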